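(* Let $E$ be an analytic space that admits a continuous map $f : E \to F$ onto a non-$\sigma$-compact metrizable space $F$ such that all fibers $f^{-1}(y)$, $y \in F$, have positive dimension. Then for any analytic extension $G$ of $E$ with $\dim(G \setminus E) \leq 0$, the set $F_0(G) = \{A \in F(G) : \dim A = 0\}$ is not a Souslin set in the Effros Borel space $(F(G), \mathscr{B}_{F(G)})$.
   Context: An analytic space is a metrizable continuous image of the irrationals. An analytic extension of $E$ is an analytic space $G$ containing $E$ as a topological subspace. For an analytic space $G$, $F(G)$ denotes the collection of all closed subsets of $G$ (including $\emptyset$), and the Effros Borel structure $\mathscr{B}_{F(G)}$ is the $\sigma$-algebra on $F(G)$ generated by the sets $\{A \in F(G) : A \cap U \neq \emptyset\}$, $U$ open in $G$. A collection $\mathscr{A} \subseteq F(G)$ is a Souslin set in $(F(G), \mathscr{B}_{F(G)})$ if it is the result of the Souslin operation on sets from $\mathscr{B}_{F(G)}$, i.e. $\mathscr{A} = \bigcup_{\sigma \in \mathbb{N}^{\mathbb{N}}} \bigcap_{n} \mathscr{A}_{\sigma|n}$ with all $\mathscr{A}_{\sigma|n} \in \mathscr{B}_{F(G)}$, where $\sigma|n$ is the restriction of $\sigma$ to its first $n$ terms. Here $\dim$ is the usual topological dimension for separable metrizable spaces (covering dimension, which coincides with small and large inductive dimension), with $\dim \emptyset = -1$. *)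

theory Defs
  imports "HOL-Analysis.Analysis"
begin

definition analytic_space :: "'a topology \<Rightarrow> bool" where
  "analytic_space X \<longleftrightarrow>
     metrizable_space X \<and>
     (\<exists>g. continuous_map (top_of_set (- \<rat> :: real set)) X g \<and> g ` (- \<rat>) = topspace X)"

definition analytic_extension :: "'a topology \<Rightarrow> 'a topology \<Rightarrow> bool" where
  "analytic_extension G E \<longleftrightarrow>
     analytic_space G \<and> topspace E \<subseteq> topspace G \<and> E = subtopology G (topspace E)"

definition sigma_compact_space :: "'a topology \<Rightarrow> bool" where
  "sigma_compact_space X \<longleftrightarrow>
     (\<exists>K :: nat \<Rightarrow> 'a set. (\<forall>n. compactin X (K n)) \<and> topspace X = (\<Union>n. K n))"

text \<open>
  Covering dimension: every finite open cover has a finite open refinement in which each point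
  lies in at most \<open>n + 1\<close> members. The library's \<open>dim_le\<close> is the small inductive
  dimension; the two agree on separable metrizable spaces.
\<close>

definition covering_dim_le :: "'a topology \<Rightarrow> int \<Rightarrow> bool" where
  "covering_dim_le X n \<longleftrightarrow>
     -1 \<le> n \<and>
     (\<forall>\<U>. finite \<U> \<and> (\<forall>U\<in>\<U>. openin X U) \<and> \<Union>\<U> = topspace X \<longrightarrow>
        (\<exists>\<V>. finite \<V> \<and> (\<forall>V\<in>\<V>. openin X V) \<and> \<Union>\<V> = topspace X \<and>
             (\<forall>V\<in>\<V>. \<exists>U\<in>\<U>. V \<subseteq> U) \<and>
             (\<forall>x\<in>topspace X. int (card {V\<in>\<V>. x \<in> V}) \<le> n + 1)))"

text \<open>The value is \<open>\<infinity>\<close> when no bound holds, and \<open>-1\<close> exactly for the empty space.\<close>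

definition covering_dim :: "'a topology \<Rightarrow> ereal" where
  "covering_dim X = Inf {ereal (of_int n) | n. covering_dim_le X n}"

definition effros_borel :: "'a topology \<Rightarrow> 'a set measure" where
  "effros_borel G =
     sigma {A. closedin G A} {{A. closedin G A \<and> A \<inter> U \<noteq> {}} | U. openin G U}"

text \<open>A finite sequence \<open>\<sigma>|n\<close> is encoded as the list of the first \<open>n\<close> values of \<open>\<sigma>\<close>.\<close>

definition souslin_set :: "'a measure \<Rightarrow> 'a set \<Rightarrow> bool" where
  "souslin_set M A \<longleftrightarrow>
     (\<exists>S :: nat list \<Rightarrow> 'a set. (\<forall>s. S s \<in> sets M) \<and>
        A = (\<Union>\<sigma> :: nat \<Rightarrow> nat. \<Inter>n. S (map \<sigma> [0..<n])))"

definition zero_dim_closed :: "'a topology \<Rightarrow> 'a set set" where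
  "zero_dim_closed G = {A. closedin G A \<and> covering_dim (subtopology G A) = 0}"

lemma covering_dim_leD: "covering_dim_le X n \<Longrightarrow> -1 \<le> n"
  unfolding covering_dim_le_def by (rule conjunct1)

lemma covering_dim_le_mono:
  assumes "covering_dim_le X m" "m \<le> n"
  shows "covering_dim_le X n"
proof -
  have "-1 \<le> n"
    using covering_dim_leD[OF assms(1)] assms(2) by (rule order_trans)
  moreover have "\<exists>\<V>. finite \<V> \<and> (\<forall>V\<in>\<V>. openin X V) \<and> \<Union>\<V> = topspace X \<and>
             (\<forall>V\<in>\<V>. \<exists>U\<in>\<U>. V \<subseteq> U) \<and>
             (\<forall>x\<in>topspace X. int (card {V\<in>\<V>. x \<in> V}) \<le> n + 1)"
    if U: "finite \<U> \<and> (\<forall>U\<in>\<U>. openin X U) \<and> \<Union>\<U> = topspace X" for \<U>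
  proof -
    from assms(1)[unfolded covering_dim_le_def, THEN conjunct2, THEN spec, THEN mp, OF U]
    obtain \<V> where \<V>: "finite \<V>" "\<forall>V\<in>\<V>. openin X V" "\<Union>\<V> = topspace X"
        "\<forall>V\<in>\<V>. \<exists>U\<in>\<U>. V \<subseteq> U"
      and c: "\<forall>x\<in>topspace X. int (card {V\<in>\<V>. x \<in> V}) \<le> m + 1"
      by (elim exE conjE)
    have c': "\<forall>x\<in>topspace X. int (card {V\<in>\<V>. x \<in> V}) \<le> n + 1"
    proof
      fix x assume x: "x \<in> topspace X"
      from bspec[OF c x] assms(2) show "int (card {V\<in>\<V>. x \<in> V}) \<le> n + 1"
        by linarith
    qed
    show ?thesis
      by (rule exI[of _ \<V>], intro conjI) (fact \<V> c')+
  qed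
  ultimately show ?thesis
    unfolding covering_dim_le_def by (intro conjI allI impI)
qed

lemma covering_dim_le_iff:
  assumes "-1 \<le> n"
  shows "covering_dim X \<le> ereal (of_int n) \<longleftrightarrow> covering_dim_le X n"
proof
  assume "covering_dim_le X n"
  then show "covering_dim X \<le> ereal (of_int n)"
    unfolding covering_dim_def by (auto intro: Inf_lower)
next
  assume le: "covering_dim X \<le> ereal (of_int n)"
  then have "covering_dim X < ereal (of_int (n + 1))"
    by (rule le_less_trans) simp
  then obtain m where "covering_dim_le X m" "ereal (of_int m) < ereal (of_int (n + 1))"
    unfolding covering_dim_def Inf_less_iff by blast
  moreover from this have "m \<le> n" by simp
  ultimately show "covering_dim_le X n"
    using covering_dim_le_mono by blast
qed

lemma covering_dim_ge: "-1 \<le> covering_dim X"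
  unfolding covering_dim_def
proof (rule Inf_greatest)
  fix z assume "z \<in> {ereal (of_int n) | n. covering_dim_le X n}"
  then obtain n where n: "z = ereal (of_int n)" "-1 \<le> n"
    using covering_dim_leD by blast
  have "(-1 :: real) \<le> of_int n"
    using n(2) by linarith
  then show "-1 \<le> z"
    unfolding n(1) by (simp add: one_ereal_def)
qed

lemma covering_dim_eq_minus_one_iff: "covering_dim X = -1 \<longleftrightarrow> topspace X = {}"
proof -
  have *: "covering_dim_le X (-1) \<longleftrightarrow> topspace X = {}"
  proof
    assume L: "covering_dim_le X (-1)"
    have cov: "finite {topspace X} \<and> (\<forall>U\<in>{topspace X}. openin X U) \<and> \<Union>{topspace X} = topspace X"
      by simp
    from L[unfolded covering_dim_le_def, THEN conjunct2, THEN spec, THEN mp, OF cov]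
    obtain \<V> where \<V>: "finite \<V>" "\<Union>\<V> = topspace X"
      and c: "\<forall>x\<in>topspace X. int (card {V\<in>\<V>. x \<in> V}) \<le> -1 + 1"
      by (elim exE conjE)
    show "topspace X = {}"
    proof (rule ccontr)
      assume "topspace X \<noteq> {}"
      then obtain x where x: "x \<in> topspace X" by blast
      have "card {V\<in>\<V>. x \<in> V} = 0" using bspec[OF c x] by simp
      with \<V>(1) have "{V\<in>\<V>. x \<in> V} = {}" by simp
      with \<V>(2) x show False by blast
    qed
  next
    assume "topspace X = {}"
    then show "covering_dim_le X (-1)"
      unfolding covering_dim_le_def by (intro conjI allI impI exI[of _ "{}"]; simp)
  qed
  have m1: "ereal (of_int (-1)) = -1"
    by (simp add: one_ereal_def)
  have "covering_dim X = -1 \<longleftrightarrow> covering_dim X \<le> ereal (of_int (-1))"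
    unfolding m1 using covering_dim_ge[of X] by (metis antisym order_refl)
  then show ?thesis
    unfolding covering_dim_le_iff[OF order_refl] * .
qed

end

theory Submission
  imports Defs
begin

text \<open>
  Suppose that the zero-dimensional closed sets form a Souslin set. The contradiction comes from a
  reduction of the well-founded trees on \<open>\<nat>\<close> to it.

  As a continuous image of \<open>E\<close>, the space \<open>F\<close> is analytic; since it is not \<open>\<sigma>\<close>-compact, it carries a
  scheme of sets \<open>W s\<close> indexed by finite sequences (\<open>hurewicz_scheme\<close>): it decreases along branches,
  each branch has a common point, and the successors of each node form a locally finite family. The
  preimages under \<open>f\<close> form a scheme \<open>A s\<close> in \<open>E\<close> such that each branch has a whole fibre of \<open>f\<close> in
  common. Finite sets \<open>D s \<subseteq> A s\<close> are chosen densely enough that along every branch they accumulate at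
  every point of this fibre (\<open>finite_traces_accumulating_at_branches\<close>). A tree \<open>T\<close> is sent to
  \<open>K\<close>, the closure in \<open>G\<close> of \<open>\<Union>s\<in>T. D s\<close>.

  If \<open>T\<close> has a branch, then \<open>K\<close> contains a fibre of positive dimension and cannot be zero-dimensional,
  because zero-dimensionality passes to subspaces (\<open>covering_dim_le_0_subspace\<close>). If \<open>T\<close> has no branch,
  then \<open>\<Union>s\<in>T. D s\<close> is locally finite in \<open>E\<close> (\<open>traces_locally_finite_if_unbranched\<close>);
  hence \<open>K\<close> consists of isolated points and of a closed subset of the remainder of \<open>E\<close> in \<open>G\<close>, whose
  dimension is at most zero, and \<open>K\<close> is zero-dimensional
  (\<open>covering_dim_le_0_closure_of_locally_finite\<close>). So \<open>K\<close> is zero-dimensional exactly for trees without a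
  branch.

  The map from \<open>T\<close> to \<open>K\<close> is Borel, so the trees without a branch would form an analytic set
  (\<open>analytic_property_effros\<close>). A diagonal tree shows that they do not (\<open>unbranched_not_analytic\<close>).
\<close>

section \<open>Analytic sets of trees\<close>

text \<open>
  The space of pairs \<open>(T, \<sigma>)\<close>, with \<open>T\<close> a set of finite sequences and \<open>\<sigma>\<close> in Baire space, carries the
  topology in which two pairs are close when they agree on long initial segments. A neighbourhood
  of \<open>T\<close> controls whole levels of \<open>T\<close> rather than finitely many nodes: this topology is not
  separable, but it suits constructions by recursion on the length of a node.
\<close>
definition agree_upto :: "nat \<Rightarrow> nat list set \<Rightarrow> (nat \<Rightarrow> nat) \<Rightarrow> nat list set \<Rightarrow> (nat \<Rightarrow> nat) \<Rightarrow> bool" where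
  "agree_upto n T \<sigma> T' \<sigma>' \<longleftrightarrow> (\<forall>t. length t < n \<longrightarrow> (t \<in> T' \<longleftrightarrow> t \<in> T)) \<and> (\<forall>i<n. \<sigma>' i = \<sigma> i)"

definition closed_relation :: "(nat list set \<Rightarrow> (nat \<Rightarrow> nat) \<Rightarrow> bool) \<Rightarrow> bool" where
  "closed_relation C \<longleftrightarrow>
     (\<forall>T \<sigma>. \<not> C T \<sigma> \<longrightarrow> (\<exists>n. \<forall>T' \<sigma>'. agree_upto n T \<sigma> T' \<sigma>' \<longrightarrow> \<not> C T' \<sigma>'))"

text \<open>
  Projections along Baire space of closed sets; they play the part of the \<open>\<Sigma>\<^sup>1\<^sub>1\<close> sets.
\<close>
definition analytic_property :: "(nat list set \<Rightarrow> bool) \<Rightarrow> bool" where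
  "analytic_property P \<longleftrightarrow> (\<exists>C. closed_relation C \<and> (\<forall>T. P T \<longleftrightarrow> (\<exists>\<sigma>. C T \<sigma>)))"

lemma analytic_property_local:
  assumes "\<And>T. \<not> P T \<Longrightarrow> \<exists>n. \<forall>T'. (\<forall>t. length t < n \<longrightarrow> (t \<in> T' \<longleftrightarrow> t \<in> T)) \<longrightarrow> \<not> P T'"
  shows "analytic_property P"
proof -
  have "closed_relation (\<lambda>T \<sigma>. P T)"
    unfolding closed_relation_def
  proof (intro allI impI)
    fix T and \<sigma> :: "nat \<Rightarrow> nat" assume "\<not> P T"
    then obtain n where "\<forall>T'. (\<forall>t. length t < n \<longrightarrow> (t \<in> T' \<longleftrightarrow> t \<in> T)) \<longrightarrow> \<not> P T'"
      using assms by meson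
    then show "\<exists>n. \<forall>T' \<sigma>'. agree_upto n T \<sigma> T' \<sigma>' \<longrightarrow> \<not> P T'"
      unfolding agree_upto_def by (intro exI[of _ n]) simp
  qed
  then show ?thesis
    unfolding analytic_property_def by (intro exI[of _ "\<lambda>T \<sigma>. P T"]) auto
qed

text \<open>
  Closure under the Souslin operation: one point of Baire space codes a branch \<open>\<sigma>\<close> together with
  witnesses \<open>\<tau>\<^sub>0, \<tau>\<^sub>1, \<dots>\<close> for all the sets along that branch, and the condition on this code is closed
  since each part of it reads finitely many coordinates. Countable intersections and
  unions are the special cases in which the sets depend only on the length of \<open>\<sigma>|n\<close>, or only on its
  first entry.
\<close>
lemma analytic_property_souslin:
  assumes "\<And>s. analytic_property (P s)"
  shows "analytic_property (\<lambda>T. \<exists>\<sigma> :: nat \<Rightarrow> nat. \<forall>n. P (map \<sigma> [0..<n]) T)"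
proof -
  obtain C where C: "\<And>s. closed_relation (C s)" and PC: "\<And>s T. P s T \<longleftrightarrow> (\<exists>\<sigma>. C s T \<sigma>)"
    using assms unfolding analytic_property_def by metis
  define row :: "nat \<Rightarrow> (nat \<Rightarrow> nat) \<Rightarrow> nat \<Rightarrow> nat" where "row k \<sigma> i = \<sigma> (prod_encode (k, i))" for k \<sigma> i
  define D where "D T \<sigma> \<longleftrightarrow> (\<forall>n. C (map (row 0 \<sigma>) [0..<n]) T (row (Suc n) \<sigma>))" for T \<sigma>
  have "closed_relation D"
    unfolding closed_relation_def
  proof (intro allI impI)
    fix T \<sigma> assume "\<not> D T \<sigma>"
    then obtain n where n: "\<not> C (map (row 0 \<sigma>) [0..<n]) T (row (Suc n) \<sigma>)"
      unfolding D_def by blast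
    obtain m where m: "\<And>T' \<tau>. agree_upto m T (row (Suc n) \<sigma>) T' \<tau> \<Longrightarrow> \<not> C (map (row 0 \<sigma>) [0..<n]) T' \<tau>"
      using C n unfolding closed_relation_def by metis
    \<comment> \<open>The level and the coordinates on which the failure of the \<open>n\<close>-th condition depends.\<close>
    define A where "A = insert m ((\<lambda>i. prod_encode (0, i)) ` {..<n} \<union> (\<lambda>i. prod_encode (Suc n, i)) ` {..<m})"
    have "finite A" unfolding A_def by simp
    define N where "N = Suc (Max A)"
    have N: "a < N" if "a \<in> A" for a
      using Max_ge[OF \<open>finite A\<close> that] unfolding N_def by simp
    have "\<not> D T' \<sigma>'" if agree: "agree_upto N T \<sigma> T' \<sigma>'" for T' \<sigma>'
    proof -
      have same: "map (row 0 \<sigma>') [0..<n] = map (row 0 \<sigma>) [0..<n]"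
        using agree N by (auto simp: row_def A_def agree_upto_def)
      moreover have "row (Suc n) \<sigma>' i = row (Suc n) \<sigma> i" if "i < m" for i
        using agree N that by (auto simp: row_def A_def agree_upto_def)
      moreover have "m < N" using N by (simp add: A_def)
      ultimately have "\<not> C (map (row 0 \<sigma>) [0..<n]) T' (row (Suc n) \<sigma>')"
        using m[of T' "row (Suc n) \<sigma>'"] agree by (simp add: agree_upto_def)
      then have "\<not> C (map (row 0 \<sigma>') [0..<n]) T' (row (Suc n) \<sigma>')"
        unfolding same .
      then show ?thesis unfolding D_def by blast
    qed
    then show "\<exists>n. \<forall>T' \<sigma>'. agree_upto n T \<sigma> T' \<sigma>' \<longrightarrow> \<not> D T' \<sigma>'" by blast
  qed
  moreover have "(\<exists>\<sigma> :: nat \<Rightarrow> nat. \<forall>n. P (map \<sigma> [0..<n]) T) \<longleftrightarrow> (\<exists>\<sigma>. D T \<sigma>)" for T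
  proof
    assume "\<exists>\<sigma> :: nat \<Rightarrow> nat. \<forall>n. P (map \<sigma> [0..<n]) T"
    then obtain \<sigma> where "\<forall>n. \<exists>\<tau>. C (map \<sigma> [0..<n]) T \<tau>" unfolding PC by blast
    then obtain \<tau> where \<tau>: "\<And>n. C (map \<sigma> [0..<n]) T (\<tau> n)" by metis
    define \<rho> where "\<rho> c = (case prod_decode c of (0, i) \<Rightarrow> \<sigma> i | (Suc n, i) \<Rightarrow> \<tau> n i)" for c
    have "row 0 \<rho> = \<sigma>" "row (Suc n) \<rho> = \<tau> n" for n
      by (auto simp: row_def \<rho>_def)
    then show "\<exists>\<sigma>. D T \<sigma>" unfolding D_def using \<tau> by metis
  next
    assume "\<exists>\<sigma>. D T \<sigma>"
    then show "\<exists>\<sigma> :: nat \<Rightarrow> nat. \<forall>n. P (map \<sigma> [0..<n]) T" unfolding D_def PC by blast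
  qed
  ultimately show ?thesis unfolding analytic_property_def by blast
qed

lemma analytic_property_all:
  assumes "\<And>n :: nat. analytic_property (P n)"
  shows "analytic_property (\<lambda>T. \<forall>n. P n T)"
  using analytic_property_souslin[of "\<lambda>s. P (length s)"] assms by simp

lemma analytic_property_ex:
  assumes "\<And>n :: nat. analytic_property (P n)"
  shows "analytic_property (\<lambda>T. \<exists>n. P n T)"
proof -
  have "analytic_property (\<lambda>T. s = [] \<or> P (hd s) T)" for s
    using assms by (cases s) (auto intro: analytic_property_local)
  from analytic_property_souslin[of "\<lambda>s T. s = [] \<or> P (hd s) T", OF this]
  have "analytic_property (\<lambda>T. \<exists>\<sigma>. \<forall>n. map \<sigma> [0..<n] = [] \<or> P (hd (map \<sigma> [0..<n])) T)" .
  moreover have "(\<exists>\<sigma>. \<forall>n. map \<sigma> [0..<n] = [] \<or> P (hd (map \<sigma> [0..<n])) T) \<longleftrightarrow> (\<exists>n. P n T)" for T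
  proof
    assume "\<exists>\<sigma>. \<forall>n. map \<sigma> [0..<n] = [] \<or> P (hd (map \<sigma> [0..<n])) T"
    then obtain \<sigma> where "\<forall>n. map \<sigma> [0..<n] = [] \<or> P (hd (map \<sigma> [0..<n])) T" ..
    from spec[OF this, of 1] show "\<exists>n. P n T" by auto
  next
    assume "\<exists>n. P n T"
    then obtain n where n: "P n T" ..
    show "\<exists>\<sigma>. \<forall>n. map \<sigma> [0..<n] = [] \<or> P (hd (map \<sigma> [0..<n])) T"
    proof (intro exI allI)
      show "map (\<lambda>_. n) [0..<k] = [] \<or> P (hd (map (\<lambda>_. n) [0..<k])) T" for k
        by (cases k) (simp_all add: map_replicate_const n del: upt_Suc)
    qed
  qed
  ultimately show ?thesis by simp
qed

text \<open>
  Having no branch is not an analytic property of trees; this is a diagonal argument. If \<open>P\<close> is the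
  projection of a closed relation \<open>C\<close>, then for each \<open>T\<close> the finite sequences that are still
  compatible with some \<open>\<sigma>\<close> satisfying \<open>C T \<sigma>\<close> form a tree whose branches are exactly these \<open>\<sigma>\<close>.
  Whether \<open>t\<close> belongs to it depends only on the nodes of \<open>T\<close> shorter than \<open>t\<close>, so recursion on the
  length yields a \<open>T\<close> that equals its own associated tree. For this \<open>T\<close> the property \<open>P\<close>
  holds if and only if \<open>T\<close> does have a branch.
\<close>
lemma unbranched_not_analytic:
  assumes "analytic_property P"
  obtains T where "[] \<in> T" "\<And>s i. s @ [i] \<in> T \<Longrightarrow> s \<in> T"
    "P T \<longleftrightarrow> (\<exists>y :: nat \<Rightarrow> nat. \<forall>n. map y [0..<n] \<in> T)"
proof -
  obtain C where C: "closed_relation C" and PC: "\<And>T. P T \<longleftrightarrow> (\<exists>\<sigma>. C T \<sigma>)"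
    using assms unfolding analytic_property_def by blast
  \<comment> \<open>\<open>R n T t\<close>: the first \<open>n\<close> levels of \<open>T\<close> and the first \<open>n\<close> terms of \<open>t\<close> extend to a pair in \<open>C\<close>.\<close>
  define R where "R n T t \<longleftrightarrow> (\<exists>T' \<sigma>'. agree_upto n T ((!) t) T' \<sigma>' \<and> C T' \<sigma>')" for n T t
  \<comment> \<open>\<open>L n\<close> is the wanted tree up to level \<open>n\<close>. Only \<open>R m\<close> with \<open>m < length t\<close> is asked of \<open>t\<close>:
    this keeps the recursion well founded and puts the root into the tree unconditionally.\<close>
  define L where "L = rec_nat {[]} (\<lambda>n L. L \<union> {t. length t = Suc n \<and> (\<forall>m\<le>n. R m L t)})"
  have L0: "L 0 = {[]}" and LS: "L (Suc n) = L n \<union> {t. length t = Suc n \<and> (\<forall>m\<le>n. R m (L n) t)}" for n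
    by (simp_all add: L_def)
  define T where "T = (\<Union>n. L n)"
  have len: "t \<in> L n \<Longrightarrow> length t \<le> n" for t n
    by (induction n) (auto simp: L0 LS)
  have mono: "m \<le> n \<Longrightarrow> L m \<subseteq> L n" for m n
    by (rule lift_Suc_mono_le[of L]) (auto simp: LS)
  have down: "t \<in> L (k + n) \<Longrightarrow> length t \<le> n \<Longrightarrow> t \<in> L n" for t k n
    by (induction k) (auto simp: LS)
  have TL: "t \<in> T \<longleftrightarrow> t \<in> L n" if "length t \<le> n" for t n
    unfolding T_def using down[of t _ n] mono that
    by (metis UN_iff UNIV_I le_add2 subsetD add.commute)
  have R_cong: "R m (L n) t \<longleftrightarrow> R m T t" if "m \<le> n" for m n t
  proof -
    have "agree_upto m (L n) ((!) t) T' \<sigma>' \<longleftrightarrow> agree_upto m T ((!) t) T' \<sigma>'" for T' \<sigma>'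
      unfolding agree_upto_def using TL[of _ n] that by auto
    then show ?thesis unfolding R_def by simp
  qed
  have T_iff: "t \<in> T \<longleftrightarrow> (\<forall>m<length t. R m T t)" for t
  proof (cases "length t")
    case 0
    then show ?thesis using TL[of t 0] by (auto simp: L0)
  next
    case (Suc n)
    have "t \<in> T \<longleftrightarrow> t \<in> L (Suc n)" using TL[of t "Suc n"] Suc by simp
    also have "\<dots> \<longleftrightarrow> (\<forall>m\<le>n. R m (L n) t)"
      using len[of t n] Suc by (auto simp: LS)
    also have "\<dots> \<longleftrightarrow> (\<forall>m<length t. R m T t)"
      using R_cong by (auto simp: Suc less_Suc_eq_le)
    finally show ?thesis .
  qed
  show thesis
  proof
    show "[] \<in> T" by (simp add: T_iff)
    show "s \<in> T" if "s @ [i] \<in> T" for s i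
    proof -
      have "R m T s" if m: "m < length s" for m
      proof -
        have "R m T (s @ [i])" using \<open>s @ [i] \<in> T\<close> m T_iff[of "s @ [i]"] by simp
        moreover have "agree_upto m T ((!) (s @ [i])) T' \<sigma>' \<longleftrightarrow> agree_upto m T ((!) s) T' \<sigma>'" for T' \<sigma>'
          using m by (auto simp: agree_upto_def nth_append)
        ultimately show ?thesis unfolding R_def by simp
      qed
      then show ?thesis by (simp add: T_iff)
    qed
    have "(\<forall>n. map y [0..<n] \<in> T) \<longleftrightarrow> C T y" for y
    proof
      assume y: "\<forall>n. map y [0..<n] \<in> T"
      have "\<exists>T' \<sigma>'. agree_upto n T y T' \<sigma>' \<and> C T' \<sigma>'" for n
      proof -
        have "R n T (map y [0..<Suc n])" using spec[OF y, of "Suc n"] T_iff[of "map y [0..<Suc n]"] by simp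
        moreover have "agree_upto n T ((!) (map y [0..<Suc n])) T' \<sigma>' \<longleftrightarrow> agree_upto n T y T' \<sigma>'" for T' \<sigma>'
          by (auto simp: agree_upto_def simp del: upt_Suc)
        ultimately show ?thesis unfolding R_def by simp
      qed
      then show "C T y" using C unfolding closed_relation_def by meson
    next
      assume Cy: "C T y"
      have "R m T (map y [0..<n])" if "m < n" for m n
        unfolding R_def by (intro exI[of _ T] exI[of _ y]) (use that Cy in \<open>simp add: agree_upto_def\<close>)
      then show "\<forall>n. map y [0..<n] \<in> T" by (simp add: T_iff)
    qed
    then show "P T \<longleftrightarrow> (\<exists>y :: nat \<Rightarrow> nat. \<forall>n. map y [0..<n] \<in> T)" by (simp add: PC)
  qed
qed

text \<open>
  The map sending \<open>T\<close> to the closure of \<open>\<Union>s\<in>T. D s\<close> is Borel with respect to the Effros structure: the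
  closure meets an open set \<open>U\<close> exactly if some \<open>D s\<close> with \<open>s \<in> T\<close> does. Preimages of Borel sets are
  therefore analytic along with their complements, and the Souslin operation leads from these to
  analytic sets.
\<close>
lemma analytic_property_effros:
  fixes G :: "'a topology" and D :: "nat list \<Rightarrow> 'a set"
  assumes "souslin_set (effros_borel G) \<A>"
  shows "analytic_property (\<lambda>T. G closure_of (\<Union>s\<in>T. D s) \<in> \<A>)"
proof -
  define \<Phi> where "\<Phi> T = G closure_of (\<Union>s\<in>T. D s)" for T
  define gen where "gen = {{A. closedin G A \<and> A \<inter> U \<noteq> {}} | U. openin G U}"
  have sets_eq: "sets (effros_borel G) = sigma_sets {A. closedin G A} gen"
    unfolding effros_borel_def gen_def by (rule sets_measure_of) auto
  have borel: "analytic_property (\<lambda>T. \<Phi> T \<in> X) \<and> analytic_property (\<lambda>T. \<Phi> T \<notin> X)"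
    if "X \<in> sigma_sets {A. closedin G A} gen" for X
    using that
  proof (induction rule: sigma_sets.induct)
    case (Basic X)
    then obtain U where U: "openin G U" and X: "X = {A. closedin G A \<and> A \<inter> U \<noteq> {}}"
      unfolding gen_def by blast
    have meets: "\<Phi> T \<in> X \<longleftrightarrow> (\<exists>s\<in>T. D s \<inter> U \<noteq> {})" for T
      using openin_Int_closure_of_eq_empty[OF U, of "\<Union>s\<in>T. D s"]
      unfolding X \<Phi>_def by (auto simp: Int_commute)
    have "analytic_property (\<lambda>T. from_nat n \<in> T \<and> D (from_nat n) \<inter> U \<noteq> {})" for n
      by (rule analytic_property_local, rule exI[of _ "Suc (length (from_nat n :: nat list))"]) auto
    from analytic_property_ex[OF this]
    have "analytic_property (\<lambda>T. \<exists>n. from_nat n \<in> T \<and> D (from_nat n) \<inter> U \<noteq> {})" .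
    moreover have "(\<exists>n. from_nat n \<in> T \<and> D (from_nat n) \<inter> U \<noteq> {}) \<longleftrightarrow> \<Phi> T \<in> X" for T
      unfolding meets by (metis from_nat_to_nat)
    ultimately have "analytic_property (\<lambda>T. \<Phi> T \<in> X)" by simp
    moreover have "analytic_property (\<lambda>T. \<Phi> T \<notin> X)"
    proof (rule analytic_property_local)
      fix T assume "\<not> \<Phi> T \<notin> X"
      then obtain s where s: "s \<in> T" "D s \<inter> U \<noteq> {}" unfolding meets by blast
      then show "\<exists>n. \<forall>T'. (\<forall>t. length t < n \<longrightarrow> (t \<in> T' \<longleftrightarrow> t \<in> T)) \<longrightarrow> \<not> \<Phi> T' \<notin> X"
        unfolding meets by (intro exI[of _ "Suc (length s)"]) auto
    qed
    ultimately show ?case ..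
  next
    case Empty
    then show ?case by (auto intro!: analytic_property_local)
  next
    case (Compl X)
    have "\<Phi> T \<in> {A. closedin G A} - X \<longleftrightarrow> \<Phi> T \<notin> X" for T
      unfolding \<Phi>_def by auto
    with Compl show ?case by simp
  next
    case (Union X)
    then have "analytic_property (\<lambda>T. \<exists>n. \<Phi> T \<in> X n)" "analytic_property (\<lambda>T. \<forall>n. \<Phi> T \<notin> X n)"
      using analytic_property_ex[of "\<lambda>n T. \<Phi> T \<in> X n"] analytic_property_all[of "\<lambda>n T. \<Phi> T \<notin> X n"]
      by simp_all
    then show ?case by simp
  qed
  obtain S where S: "\<And>s. S s \<in> sets (effros_borel G)"
    and A: "\<A> = (\<Union>\<sigma> :: nat \<Rightarrow> nat. \<Inter>n. S (map \<sigma> [0..<n]))"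
    using assms unfolding souslin_set_def by blast
  have "analytic_property (\<lambda>T. \<Phi> T \<in> S s)" for s
    using borel S sets_eq by blast
  from analytic_property_souslin[of "\<lambda>s T. \<Phi> T \<in> S s", OF this]
  show ?thesis unfolding A \<Phi>_def by simp
qed

section \<open>Zero-dimensional metrizable spaces\<close>

lemma covering_dim_le_0_iff: "covering_dim X \<le> 0 \<longleftrightarrow> covering_dim_le X 0"
  using covering_dim_le_iff[of 0 X] by (simp add: zero_ereal_def)

lemma covering_dim_eq_0_iff: "covering_dim X = 0 \<longleftrightarrow> covering_dim_le X 0 \<and> topspace X \<noteq> {}"
proof -
  have "topspace X = {}" if neg: "covering_dim X < 0"
  proof -
    obtain n where n: "covering_dim_le X n" "ereal (of_int n) < 0"
      using neg unfolding covering_dim_def Inf_less_iff by blast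
    then have "n = -1" using covering_dim_leD[OF n(1)] by simp
    then have "covering_dim X \<le> -1"
      using n(1) covering_dim_le_iff[of "-1" X] by (simp add: one_ereal_def)
    then have "covering_dim X = -1" using covering_dim_ge[of X] by (rule antisym)
    then show ?thesis by (simp add: covering_dim_eq_minus_one_iff)
  qed
  moreover have "topspace X \<noteq> {}" if "covering_dim X = 0"
  proof
    assume "topspace X = {}"
    then have "covering_dim X = -1" by (simp add: covering_dim_eq_minus_one_iff)
    with that show False by simp
  qed
  ultimately show ?thesis using covering_dim_le_0_iff by (metis order_refl order_le_less)
qed

text \<open>
  In dimension zero a refinement is a partition into open sets, which amounts to a locally constant
  choice \<open>c\<close> of a member of the cover around each point. In this form disjointness is automatic, and
  the cover may consist of open sets of the ambient space.
\<close>
lemma covering_dim_le_0_subtopology_iff: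
  "covering_dim_le (subtopology X S) 0 \<longleftrightarrow>
     (\<forall>\<U>. finite \<U> \<and> (\<forall>U\<in>\<U>. openin X U) \<and> topspace X \<inter> S \<subseteq> \<Union>\<U> \<longrightarrow>
        (\<exists>c. (\<forall>x\<in>topspace X \<inter> S. x \<in> c x \<and> c x \<in> \<U>) \<and>
             (\<forall>U. openin (subtopology X S) {x \<in> topspace X \<inter> S. c x = U})))"
  (is "_ \<longleftrightarrow> ?R")
proof
  assume dim: "covering_dim_le (subtopology X S) 0"
  show ?R
  proof (intro allI impI, elim conjE)
    fix \<U> assume \<U>: "finite \<U>" "\<forall>U\<in>\<U>. openin X U" "topspace X \<inter> S \<subseteq> \<Union>\<U>"
    have "\<Union>((\<lambda>U. S \<inter> U) ` \<U>) = topspace X \<inter> S"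
      using \<U>(3) \<U>(2)[THEN bspec, THEN openin_subset] by auto
    then have cover: "finite ((\<lambda>U. S \<inter> U) ` \<U>) \<and> (\<forall>U\<in>(\<lambda>U. S \<inter> U) ` \<U>. openin (subtopology X S) U) \<and>
          \<Union>((\<lambda>U. S \<inter> U) ` \<U>) = topspace (subtopology X S)"
      using \<U>(1,2) by (simp add: openin_subtopology_Int2)
    obtain \<V> where \<V>: "finite \<V>" "\<forall>V\<in>\<V>. openin (subtopology X S) V"
        "\<Union>\<V> = topspace (subtopology X S)" "\<forall>V\<in>\<V>. \<exists>U\<in>(\<lambda>U. S \<inter> U) ` \<U>. V \<subseteq> U"
      and card: "\<forall>x\<in>topspace (subtopology X S). int (card {V\<in>\<V>. x \<in> V}) \<le> 0 + 1"
      using dim[unfolded covering_dim_le_def, THEN conjunct2, THEN spec, THEN mp, OF cover]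
      by (elim exE conjE)
    have "\<forall>V\<in>\<V>. \<exists>U\<in>\<U>. V \<subseteq> U" using \<V>(4) by auto
    then obtain r where r: "\<And>V. V \<in> \<V> \<Longrightarrow> r V \<in> \<U> \<and> V \<subseteq> r V" by metis
    have "\<forall>x\<in>topspace X \<inter> S. \<exists>V\<in>\<V>. x \<in> V" using \<V>(3) by auto
    then obtain v where v: "\<And>x. x \<in> topspace X \<inter> S \<Longrightarrow> v x \<in> \<V> \<and> x \<in> v x" by metis
    have uniq: "V = v x" if "x \<in> topspace X \<inter> S" "V \<in> \<V>" "x \<in> V" for x V
    proof -
      have "card {V\<in>\<V>. x \<in> V} \<le> 1" using card that(1) by auto
      then show ?thesis using card_le_Suc0_iff_eq[of "{V\<in>\<V>. x \<in> V}"] \<V>(1) that v by auto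
    qed
    have "openin (subtopology X S) {x \<in> topspace X \<inter> S. r (v x) = U}" for U
    proof -
      have "{x \<in> topspace X \<inter> S. r (v x) = U} = \<Union>{V \<in> \<V>. r V = U}"
      proof (intro equalityI subsetI)
        fix x assume "x \<in> {x \<in> topspace X \<inter> S. r (v x) = U}"
        then show "x \<in> \<Union>{V \<in> \<V>. r V = U}" using v by blast
      next
        fix x assume "x \<in> \<Union>{V \<in> \<V>. r V = U}"
        then obtain V where V: "V \<in> \<V>" "x \<in> V" "r V = U" by blast
        have "x \<in> topspace X \<inter> S" using V \<V>(3) by auto
        then show "x \<in> {x \<in> topspace X \<inter> S. r (v x) = U}" using V uniq by blast
      qed
      then show ?thesis using \<V>(2) by auto
    qed
    then show "\<exists>c. (\<forall>x\<in>topspace X \<inter> S. x \<in> c x \<and> c x \<in> \<U>) \<and>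
             (\<forall>U. openin (subtopology X S) {x \<in> topspace X \<inter> S. c x = U})"
      by (intro exI[of _ "\<lambda>x. r (v x)"] conjI allI ballI) (use r v in \<open>auto\<close>)
  qed
next
  assume R: ?R
  show "covering_dim_le (subtopology X S) 0"
    unfolding covering_dim_le_def
  proof (intro conjI allI impI, simp, elim conjE)
    fix \<U> assume \<U>: "finite \<U>" "\<forall>U\<in>\<U>. openin (subtopology X S) U" "\<Union>\<U> = topspace (subtopology X S)"
    have "\<forall>U\<in>\<U>. \<exists>W. openin X W \<and> U = W \<inter> S" using \<U>(2) by (auto simp: openin_subtopology)
    then obtain e where e: "\<And>U. U \<in> \<U> \<Longrightarrow> openin X (e U) \<and> U = e U \<inter> S" by metis
    have cover: "finite (e ` \<U>) \<and> (\<forall>U\<in>e ` \<U>. openin X U) \<and> topspace X \<inter> S \<subseteq> \<Union>(e ` \<U>)"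
    proof (intro conjI ballI subsetI)
      fix x assume "x \<in> topspace X \<inter> S"
      then obtain U where "U \<in> \<U>" "x \<in> U" using \<U>(3) by auto
      then show "x \<in> \<Union>(e ` \<U>)" using e[of U] by blast
    qed (use \<U>(1) e in auto)
    obtain c where c: "\<forall>x\<in>topspace X \<inter> S. x \<in> c x \<and> c x \<in> e ` \<U>"
        "\<forall>U. openin (subtopology X S) {x \<in> topspace X \<inter> S. c x = U}"
      using R[THEN spec, THEN mp, OF cover] by (elim exE conjE)
    define lev where "lev U = {x \<in> topspace X \<inter> S. c x = e U}" for U
    show "\<exists>\<V>. finite \<V> \<and> (\<forall>V\<in>\<V>. openin (subtopology X S) V) \<and> \<Union>\<V> = topspace (subtopology X S) \<and>
             (\<forall>V\<in>\<V>. \<exists>U\<in>\<U>. V \<subseteq> U) \<and>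
             (\<forall>x\<in>topspace (subtopology X S). int (card {V\<in>\<V>. x \<in> V}) \<le> 0 + 1)"
    proof (intro exI[of _ "lev ` \<U>"] conjI ballI)
      show "finite (lev ` \<U>)" using \<U>(1) by simp
      show "openin (subtopology X S) V" if "V \<in> lev ` \<U>" for V
        using that c(2) by (auto simp: lev_def)
      show "\<Union>(lev ` \<U>) = topspace (subtopology X S)"
      proof (intro equalityI subsetI)
        fix x assume "x \<in> topspace (subtopology X S)"
        then have x: "x \<in> topspace X \<inter> S" by simp
        then obtain U where "U \<in> \<U>" "c x = e U" using c(1) by blast
        then show "x \<in> \<Union>(lev ` \<U>)" using x by (auto simp: lev_def)
      qed (auto simp: lev_def)
      show "\<exists>U\<in>\<U>. V \<subseteq> U" if V: "V \<in> lev ` \<U>" for V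
      proof -
        from V obtain U where U: "U \<in> \<U>" "V = lev U" by blast
        have "V \<subseteq> e U \<inter> S" unfolding U(2) lev_def using c(1) by auto
        then show ?thesis using e U by metis
      qed
      fix x assume x: "x \<in> topspace (subtopology X S)"
      then obtain U where "U \<in> \<U>" "c x = e U" using c(1) by auto
      then have "{V \<in> lev ` \<U>. x \<in> V} \<subseteq> {lev U}"
        by (auto simp: lev_def)
      then have "card {V \<in> lev ` \<U>. x \<in> V} \<le> card {lev U}"
        by (intro card_mono) auto
      then show "int (card {V \<in> lev ` \<U>. x \<in> V}) \<le> 0 + 1" by simp
    qed
  qed
qed

text \<open>
  A cover of a subset \<open>S\<close> by open sets of \<open>X\<close> also covers the open set \<open>\<Union>\<U>\<close>, so it is enough to find a
  locally constant choice there. An open set is a countable union of closed sets \<open>K n\<close>.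
  Zero-dimensionality gives, for each \<open>n\<close>, a locally constant choice from \<open>\<U>\<close> together with the
  complement of \<open>K n\<close>, and this choice lies in \<open>\<U>\<close> on \<open>K n\<close>. Taking at each point the first \<open>n\<close> for which
  it lies in \<open>\<U>\<close> combines these choices into one.
\<close>
lemma covering_dim_le_0_subspace:
  assumes "metrizable_space X" and dim: "covering_dim_le X 0"
  shows "covering_dim_le (subtopology X S) 0"
  unfolding covering_dim_le_0_subtopology_iff
proof (intro allI impI, elim conjE)
  fix \<U> assume \<U>: "finite \<U>" "\<forall>U\<in>\<U>. openin X U" "topspace X \<inter> S \<subseteq> \<Union>\<U>"
  have "openin X (\<Union>\<U>)" using \<U>(2) by blast
  then have "fsigma_in X (\<Union>\<U>)"
    using assms(1) open_imp_fsigma_in by blast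
  then obtain K where K: "\<forall>n. closedin X (K n)" and "\<forall>n. K n \<subseteq> K (Suc n)" and K_Un: "\<Union>(range K) = \<Union>\<U>"
    unfolding fsigma_in_ascending by (elim exE conjE)
  have dimX: "covering_dim_le (subtopology X (topspace X)) 0" using dim by simp
  define out where "out n = topspace X - K n" for n :: nat
  have "\<exists>c. (\<forall>x\<in>topspace X. x \<in> c x \<and> c x \<in> insert (out n) \<U>) \<and>
             (\<forall>U. openin X {x \<in> topspace X. c x = U})" for n
  proof -
    have "openin X (out n)" using K by (auto simp: out_def)
    moreover have "topspace X \<subseteq> \<Union>(insert (out n) \<U>)" using K_Un by (auto simp: out_def)
    ultimately show ?thesis
      using dimX[unfolded covering_dim_le_0_subtopology_iff, THEN spec, THEN mp, of "insert (out n) \<U>"] \<U>(1,2)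
      by simp
  qed
  then obtain c where c: "\<And>n x. x \<in> topspace X \<Longrightarrow> x \<in> c n x \<and> c n x \<in> insert (out n) \<U>"
    and opn: "\<And>n U. openin X {x \<in> topspace X. c n x = U}"
    by metis
  define N where "N x = (LEAST n. c n x \<noteq> out n)" for x
  have N: "c (N x) x \<noteq> out (N x)" if x: "x \<in> topspace X" "x \<in> \<Union>\<U>" for x
  proof -
    obtain n where "x \<in> K n" using K_Un x(2) by blast
    then have "c n x \<noteq> out n" using c[of x n] x by (auto simp: out_def)
    then show ?thesis unfolding N_def by (rule LeastI)
  qed
  have opn_below: "openin X {x \<in> topspace X. \<forall>m<n. c m x = out m}" for n
  proof (induction n)
    case (Suc n)
    have "{x \<in> topspace X. \<forall>m<Suc n. c m x = out m} =
        {x \<in> topspace X. \<forall>m<n. c m x = out m} \<inter> {x \<in> topspace X. c n x = out n}"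
      by (auto simp: less_Suc_eq)
    then show ?case using Suc opn by auto
  qed simp
  have "openin (subtopology X S) {x \<in> topspace X \<inter> S. c (N x) x = U}" for U
  proof -
    define W where "W n = (if U = out n then {} else {x \<in> topspace X. c n x = U} \<inter> {x \<in> topspace X. \<forall>m<n. c m x = out m})" for n
    have "openin X (W n)" for n
      using opn opn_below by (auto simp: W_def)
    then have "openin X (\<Union>(range W))" by blast
    moreover have "{x \<in> topspace X \<inter> S. c (N x) x = U} = S \<inter> \<Union>(range W)"
    proof (intro equalityI subsetI)
      fix x assume x: "x \<in> {x \<in> topspace X \<inter> S. c (N x) x = U}"
      then have "c (N x) x \<noteq> out (N x)" using N \<U>(3) by blast
      moreover have "\<forall>m<N x. c m x = out m" unfolding N_def using not_less_Least by blast
      ultimately have "x \<in> W (N x)" using x by (auto simp: W_def)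
      then show "x \<in> S \<inter> \<Union>(range W)" using x by blast
    next
      fix x assume "x \<in> S \<inter> \<Union>(range W)"
      then obtain n where x: "x \<in> S" "x \<in> W n" by blast
      then have xn: "x \<in> topspace X" "c n x = U" "U \<noteq> out n" "\<forall>m<n. c m x = out m"
        by (auto simp: W_def split: if_splits)
      have "N x = n" unfolding N_def
        by (rule Least_equality) (use xn in \<open>auto simp: not_less[symmetric]\<close>)
      then show "x \<in> {x \<in> topspace X \<inter> S. c (N x) x = U}" using x xn by simp
    qed
    ultimately show ?thesis by (simp add: openin_subtopology_Int2)
  qed
  moreover have "x \<in> c (N x) x \<and> c (N x) x \<in> \<U>" if "x \<in> topspace X \<inter> S" for x
    using c[of x "N x"] N[of x] that \<U>(3) by auto
  ultimately show "\<exists>c. (\<forall>x\<in>topspace X \<inter> S. x \<in> c x \<and> c x \<in> \<U>) \<and>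
             (\<forall>U. openin (subtopology X S) {x \<in> topspace X \<inter> S. c x = U})"
    by (intro exI[of _ "\<lambda>x. c (N x) x"]) blast
qed

text \<open>
  A partition of \<open>C\<close> refining the cover swells, by normality, to disjoint open sets \<open>V U \<subseteq> U\<close>. The
  points that these miss are isolated and can be assigned to members of the cover arbitrarily.
\<close>
lemma covering_dim_le_0_add_isolated_points:
  assumes "normal_space X" "closedin X C" and dim: "covering_dim_le (subtopology X C) 0"
    and isolated: "\<And>x. x \<in> topspace X - C \<Longrightarrow> openin X {x}"
  shows "covering_dim_le X 0"
proof -
  have CX: "C \<subseteq> topspace X" "topspace X \<inter> C = C" using closedin_subset[OF assms(2)] by auto
  have "\<exists>c. (\<forall>x\<in>topspace X. x \<in> c x \<and> c x \<in> \<U>) \<and> (\<forall>U. openin X {x \<in> topspace X. c x = U})"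
    if \<U>: "finite \<U>" "\<forall>U\<in>\<U>. openin X U" "topspace X \<subseteq> \<Union>\<U>" for \<U>
  proof -
    have "C \<subseteq> \<Union>\<U>" using \<U>(3) CX(1) by (rule order_trans[rotated])
    then have "\<exists>c. (\<forall>x\<in>C. x \<in> c x \<and> c x \<in> \<U>) \<and> (\<forall>U. openin (subtopology X C) {x \<in> C. c x = U})"
      using dim[unfolded covering_dim_le_0_subtopology_iff, THEN spec, THEN mp, of \<U>] \<U>(1,2) CX(2) by simp
    then obtain c where c: "\<And>x. x \<in> C \<Longrightarrow> x \<in> c x \<and> c x \<in> \<U>"
      and opn: "\<And>U. openin (subtopology X C) {x \<in> C. c x = U}"
      by metis
    have clo: "closedin X {x \<in> C. P (c x)}" for P
    proof -
      have op: "openin (subtopology X C) (\<Union>U\<in>{U. \<not> P U}. {x \<in> C. c x = U})"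
        using opn by blast
      have eq: "{x \<in> C. P (c x)} = topspace (subtopology X C) - (\<Union>U\<in>{U. \<not> P U}. {x \<in> C. c x = U})"
        using CX by auto
      have "closedin (subtopology X C) {x \<in> C. P (c x)}"
        unfolding eq by (rule closedin_diff[OF closedin_topspace op])
      then show ?thesis using closedin_trans_full assms(2) by blast
    qed
    define L L' where "L U = {x \<in> C. c x = U}" and "L' U = {x \<in> C. c x \<noteq> U}" for U
    have "\<exists>A B. openin X A \<and> openin X B \<and> L U \<subseteq> A \<and> L' U \<subseteq> B \<and> disjnt A B" for U
    proof -
      have "closedin X (L U) \<and> closedin X (L' U) \<and> disjnt (L U) (L' U)"
        using clo[of "\<lambda>V. V = U"] clo[of "\<lambda>V. V \<noteq> U"] by (simp add: disjnt_iff L_def L'_def)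
      from assms(1)[unfolded normal_space_def, THEN spec, THEN spec, THEN mp, OF this] show ?thesis .
    qed
    then obtain A B where AB: "\<And>U. openin X (A U)" "\<And>U. openin X (B U)" "\<And>U. L U \<subseteq> A U"
        "\<And>U. L' U \<subseteq> B U" "\<And>U. disjnt (A U) (B U)"
      by metis
    define V where "V U = U \<inter> A U \<inter> (topspace X \<inter> \<Inter>(B ` (\<U> - {U})))" for U
    have "openin X (topspace X \<inter> \<Inter>(B ` (\<U> - {U})))" for U
      using AB(2) \<U>(1) openin_Inter[of "insert (topspace X) (B ` (\<U> - {U}))" X] by auto
    then have opV: "openin X (V U)" if "U \<in> \<U>" for U
      unfolding V_def using AB(1) \<U>(2) that by blast
    have CV: "x \<in> V (c x)" if "x \<in> C" for x
    proof -
      have "x \<in> A (c x)" using AB(3)[of "c x"] that by (auto simp: L_def)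
      moreover have "x \<in> B U" if "U \<noteq> c x" for U
        using AB(4)[of U] that \<open>x \<in> C\<close> by (auto simp: L'_def)
      ultimately show ?thesis using c[OF that] that CX(1) by (auto simp: V_def)
    qed
    have disj: "U = U'" if "x \<in> V U" "x \<in> V U'" "U \<in> \<U>" "U' \<in> \<U>" for x U U'
    proof (rule ccontr)
      assume "U \<noteq> U'"
      then have "x \<in> A U" "x \<in> B U" using that by (auto simp: V_def)
      then show False using AB(5)[of U] by (simp add: disjnt_iff)
    qed
    define d where "d x = (if \<exists>U\<in>\<U>. x \<in> V U then SOME U. U \<in> \<U> \<and> x \<in> V U else SOME U. U \<in> \<U> \<and> x \<in> U)" for x
    have dV: "d x = U" if "U \<in> \<U>" "x \<in> V U" for x U
    proof -
      have "d x = (SOME U. U \<in> \<U> \<and> x \<in> V U)" using that by (auto simp: d_def)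
      moreover have "(SOME U. U \<in> \<U> \<and> x \<in> V U) = U"
        using that disj by (intro some_equality) auto
      ultimately show ?thesis by simp
    qed
    have d: "x \<in> d x \<and> d x \<in> \<U>" if x: "x \<in> topspace X" for x
    proof (cases "\<exists>U\<in>\<U>. x \<in> V U")
      case True
      then show ?thesis using dV by (auto simp: V_def)
    next
      case False
      then have "d x = (SOME U. U \<in> \<U> \<and> x \<in> U)" by (simp add: d_def)
      moreover have "\<exists>U. U \<in> \<U> \<and> x \<in> U" using x \<U>(3) by blast
      ultimately show ?thesis using someI_ex[of "\<lambda>U. U \<in> \<U> \<and> x \<in> U"] by simp
    qed
    have "openin X {x \<in> topspace X. d x = U}" for U
    proof (subst openin_subopen, intro ballI)
      fix x assume x: "x \<in> {x \<in> topspace X. d x = U}"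
      show "\<exists>T. openin X T \<and> x \<in> T \<and> T \<subseteq> {x \<in> topspace X. d x = U}"
      proof (cases "x \<in> C")
        case True
        have cx: "c x \<in> \<U>" "x \<in> V (c x)" using c CV True by auto
        have "y \<in> topspace X \<and> d y = U" if "y \<in> V (c x)" for y
          using dV[OF cx(1) that] dV[OF cx] x that openin_subset[OF opV[OF cx(1)]] by auto
        then show ?thesis using opV cx by (intro exI[of _ "V (c x)"]) auto
      next
        case False
        then show ?thesis using isolated[of x] x by (intro exI[of _ "{x}"]) auto
      qed
    qed
    then show ?thesis using d by blast
  qed
  then show ?thesis
    using covering_dim_le_0_subtopology_iff[of X "topspace X"] by simp
qed

text \<open>
  By local finiteness every point of the closure that lies in \<open>S\<close> is isolated in the closure, so the
  closure is a closed zero-dimensional part outside \<open>S\<close> with isolated points added.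
\<close>
lemma covering_dim_le_0_closure_of_locally_finite:
  assumes G: "metrizable_space G" and S: "S \<subseteq> topspace G" "D \<subseteq> S"
    and local: "\<And>x. x \<in> S \<Longrightarrow> \<exists>U. openin (subtopology G S) U \<and> x \<in> U \<and> finite (U \<inter> D)"
    and dim: "covering_dim_le (subtopology G (topspace G - S)) 0"
  shows "covering_dim_le (subtopology G (G closure_of D)) 0"
proof -
  define K where "K = G closure_of D"
  have K: "K \<subseteq> topspace G" unfolding K_def by (rule closure_of_subset_topspace)
  have top: "topspace (subtopology G K) = K" using K by auto
  have isolated: "openin (subtopology G K) {x}" if x: "x \<in> K" "x \<in> S" for x
  proof -
    obtain U where U: "openin (subtopology G S) U" "x \<in> U" "finite (U \<inter> D)" using local[OF x(2)] by blast
    obtain U' where U': "openin G U'" "U = U' \<inter> S" using U(1) by (auto simp: openin_subtopology)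
    have H: "Hausdorff_space G" using G by (rule metrizable_imp_Hausdorff_space)
    have closed: "closedin G F" if "finite F" "F \<subseteq> topspace G" for F
      using H that by (simp add: closedin_Hausdorff_finite)
    define B where "B = U' - (U \<inter> D - {x})"
    have "openin G B" unfolding B_def
      using U'(1) by (rule openin_diff) (use U(3) S in \<open>auto intro: closed\<close>)
    have "x \<in> B" using U(2) U'(2) by (simp add: B_def)
    have "K \<inter> B \<subseteq> {x}"
    proof
      fix z assume z: "z \<in> K \<inter> B"
      show "z \<in> {x}"
      proof (rule ccontr)
        assume "z \<notin> {x}"
        then have "z \<in> B - {x}" using z by simp
        moreover have "openin G (B - {x})"
          using \<open>openin G B\<close> by (rule openin_diff) (use x(1) K in \<open>auto intro: closed\<close>)
        moreover have "z \<in> G closure_of D" using z by (simp add: K_def)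
        ultimately obtain d where "d \<in> D" "d \<in> B - {x}"
          unfolding in_closure_of by meson
        then show False using U'(2) S(2) by (auto simp: B_def)
      qed
    qed
    then have "{x} = K \<inter> B" using x(1) \<open>x \<in> B\<close> by blast
    then show ?thesis using \<open>openin G B\<close> by (simp add: openin_subtopology_Int2)
  qed
  have "covering_dim_le (subtopology G K) 0"
  proof (rule covering_dim_le_0_add_isolated_points)
    have "metrizable_space (subtopology G K)" using G by (rule metrizable_space_subtopology)
    then show "normal_space (subtopology G K)" by (rule metrizable_imp_normal_space)
    have "openin (subtopology G K) (\<Union>x\<in>K \<inter> S. {x})" using isolated by (intro openin_Union) auto
    then have "closedin (subtopology G K) (topspace (subtopology G K) - (\<Union>x\<in>K \<inter> S. {x}))" by blast
    moreover have "topspace (subtopology G K) - (\<Union>x\<in>K \<inter> S. {x}) = K - S" unfolding top by auto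
    ultimately show "closedin (subtopology G K) (K - S)" by simp
    have "subtopology (subtopology G K) (K - S) = subtopology (subtopology G (topspace G - S)) (K - S)"
    proof -
      have "K \<inter> (K - S) = (topspace G - S) \<inter> (K - S)" using K by auto
      then show ?thesis by (simp add: subtopology_subtopology)
    qed
    then show "covering_dim_le (subtopology (subtopology G K) (K - S)) 0"
      using covering_dim_le_0_subspace[OF metrizable_space_subtopology[OF G] dim] by simp
    show "openin (subtopology G K) {x}" if "x \<in> topspace (subtopology G K) - (K - S)" for x
      using that isolated top by auto
  qed
  then show ?thesis by (simp add: K_def)
qed

section \<open>Analytic spaces that are not \<open>\<sigma>\<close>-compact\<close>

lemma analytic_space_continuous_map_image:
  assumes "analytic_space E" "continuous_map E F f" "f ` topspace E = topspace F" "metrizable_space F"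
  shows "analytic_space F"
proof -
  obtain g where g: "continuous_map (top_of_set (- \<rat> :: real set)) E g" "g ` (- \<rat>) = topspace E"
    using assms(1) unfolding analytic_space_def by blast
  have "continuous_map (top_of_set (- \<rat>)) F (f \<circ> g)"
    using g(1) assms(2) by (rule continuous_map_compose)
  moreover have "(f \<circ> g) ` (- \<rat>) = topspace F"
    using g(2) assms(3) by (metis image_comp)
  ultimately show ?thesis
    using assms(4) unfolding analytic_space_def by blast
qed

text \<open>
  Dependent choice along the tree of finite sequences, where all immediate successors of a node are
  chosen simultaneously: the condition \<open>Q\<close> may relate infinitely many of them.
\<close>
lemma tree_dependent_choice:
  fixes P :: "nat list \<Rightarrow> 'x \<Rightarrow> bool"
  assumes root: "P [] a"
    and step: "\<And>s x. P s x \<Longrightarrow> \<exists>x'. (\<forall>i. P (s @ [i]) (x' i)) \<and> Q s x x'"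
  obtains X where "\<And>s. P s (X s)" "\<And>s. Q s (X s) (\<lambda>i. X (s @ [i]))"
proof -
  have "\<forall>s x. \<exists>x'. P s x \<longrightarrow> (\<forall>i. P (s @ [i]) (x' i)) \<and> Q s x x'"
    using step by blast
  then obtain nx where nx: "\<And>s x. P s x \<Longrightarrow> (\<forall>i. P (s @ [i]) (nx s x i)) \<and> Q s x (nx s x)"
    by metis
  define Y where "Y = rec_list a (\<lambda>i t x. nx (rev t) x i)"
  define X where "X s = Y (rev s)" for s
  have X: "X [] = a" "X (s @ [i]) = nx s (X s) i" for s i
    by (simp_all add: X_def Y_def)
  have PX: "P s (X s)" for s
    by (induction s rule: rev_induct) (use root nx X in auto)
  show thesis
    by (rule that[of X]) (use PX nx X in auto)
qed

text \<open>
  Subsets of \<open>\<sigma>\<close>-compact sets form a \<open>\<sigma>\<close>-ideal; arbitrary countable families of compact sets make this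
  immediate.
\<close>
definition in_sigma_compact :: "'a topology \<Rightarrow> 'a set \<Rightarrow> bool" where
  "in_sigma_compact X S \<longleftrightarrow> (\<exists>\<K>. countable \<K> \<and> (\<forall>K\<in>\<K>. compactin X K) \<and> S \<subseteq> \<Union>\<K>)"

lemma in_sigma_compact_subset: "in_sigma_compact X T \<Longrightarrow> S \<subseteq> T \<Longrightarrow> in_sigma_compact X S"
  unfolding in_sigma_compact_def by (meson subset_trans)

lemma in_sigma_compact_UN:
  assumes "countable I" "\<And>i. i \<in> I \<Longrightarrow> in_sigma_compact X (S i)"
  shows "in_sigma_compact X (\<Union>i\<in>I. S i)"
proof -
  obtain \<K> where \<K>: "\<And>i. i \<in> I \<Longrightarrow> countable (\<K> i) \<and> (\<forall>K\<in>\<K> i. compactin X K) \<and> S i \<subseteq> \<Union>(\<K> i)"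
    using assms(2) unfolding in_sigma_compact_def by metis
  show ?thesis
    unfolding in_sigma_compact_def
  proof (intro exI[of _ "\<Union>i\<in>I. \<K> i"] conjI)
    show "countable (\<Union>i\<in>I. \<K> i)" using assms(1) \<K> by auto
    show "\<forall>K\<in>\<Union>i\<in>I. \<K> i. compactin X K" using \<K> by auto
    show "(\<Union>i\<in>I. S i) \<subseteq> \<Union>(\<Union>i\<in>I. \<K> i)" using \<K> by fastforce
  qed
qed

lemma in_sigma_compact_Un:
  assumes "in_sigma_compact X S" "in_sigma_compact X T"
  shows "in_sigma_compact X (S \<union> T)"
  using in_sigma_compact_UN[of "UNIV :: bool set" X "\<lambda>b. if b then S else T"] assms
  by (simp add: UNIV_bool Un_commute)

lemma sigma_compact_space_if_in_sigma_compact: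
  assumes "in_sigma_compact X (topspace X)"
  shows "sigma_compact_space X"
proof -
  obtain \<K> where \<K>: "countable \<K>" "\<forall>K\<in>\<K>. compactin X K" "topspace X \<subseteq> \<Union>\<K>"
    using assms unfolding in_sigma_compact_def by (elim exE conjE)
  let ?K = "from_nat_into (insert {} \<K>)"
  have range: "range ?K = insert {} \<K>" using \<K>(1) by (simp add: range_from_nat_into)
  have "compactin X (?K n)" for n
    using from_nat_into[of "insert {} \<K>" n] \<K>(2) by auto
  moreover have "\<Union>(range ?K) = topspace X"
    unfolding range using \<K>(2,3) compactin_subset_topspace by fastforce
  ultimately show ?thesis
    unfolding sigma_compact_space_def by metis
qed

text \<open>
  If the closure of \<open>h ` S\<close> is not compact, then \<open>h ` S\<close> contains an infinite closed discrete set of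
  points \<open>w i\<close>. Balls around the \<open>w i\<close> with radii tending to \<open>0\<close> form a locally finite family, since a
  point met by infinitely many of them nearby would be a limit of the \<open>w i\<close>. Continuity pulls these
  balls back to neighbourhoods of preimages of the \<open>w i\<close>.
\<close>
lemma locally_finite_neighbourhood_images:
  fixes h :: "'a :: euclidean_space \<Rightarrow> 'b"
  assumes F: "metrizable_space F" and h: "continuous_map (top_of_set A) F h"
    and "S \<subseteq> A" "S \<subseteq> V" "open V"
    and noncompact: "\<not> compactin F (F closure_of (h ` S))"
  obtains z r where "\<And>i :: nat. z i \<in> S" "\<And>i. r i > 0" "\<And>i. cball (z i) (r i) \<subseteq> V"
    "\<And>q. q \<in> topspace F \<Longrightarrow> \<exists>U. openin F U \<and> q \<in> U \<and> finite {i. h ` (cball (z i) (r i) \<inter> A) \<inter> U \<noteq> {}}"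
proof -
  obtain M d where Md: "Metric_space M d" and F_eq: "F = Metric_space.mtopology M d"
    using F unfolding metrizable_space_def by blast
  interpret Metric_space M d by (rule Md)
  have hA: "h x \<in> M" if "x \<in> A" for x
    using continuous_map_image_subset_topspace[OF h] that unfolding F_eq by auto
  obtain T where T: "infinite T" "T \<subseteq> h ` S" "T \<subseteq> M" "F derived_set_of T = {}"
    using noncompact compact_closure_of_eq_Bolzano_Weierstrass[of "h ` S"] unfolding F_eq by blast
  obtain w :: "nat \<Rightarrow> 'b" where w: "inj w" "range w \<subseteq> T"
    using infinite_countable_subset[OF T(1)] by blast
  have "w i \<in> h ` S" for i using rangeI[of w i] w(2) T(2) by (meson subsetD)
  then have "\<forall>i. \<exists>x. x \<in> S \<and> h x = w i" by (metis imageE)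
  then obtain z where z: "\<And>i. z i \<in> S" "\<And>i. h (z i) = w i" by metis
  have wT: "w i \<in> T" for i using rangeI[of w i] w(2) by (rule subsetD[rotated])
  have wM: "w i \<in> M" for i using rangeI[of w i] w(2) T(3) by (meson subsetD)
  have "\<exists>r>0. cball (z i) r \<subseteq> V \<and> h ` (cball (z i) r \<inter> A) \<subseteq> mball (w i) (1 / Suc i)" for i
  proof -
    have "openin (top_of_set A) {x \<in> topspace (top_of_set A). h x \<in> mball (w i) (1 / Suc i)}"
      using h by (rule openin_continuous_map_preimage) (simp add: F_eq)
    then obtain U where U: "open U" "{x \<in> A. h x \<in> mball (w i) (1 / Suc i)} = A \<inter> U"
      by (auto simp: openin_open)
    have "h (z i) \<in> mball (w i) (1 / Suc i)" using z(2) wM by simp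
    then have "z i \<in> U \<inter> V" using U(2) z(1) assms(3,4) by blast
    then obtain r where "r > 0" "cball (z i) r \<subseteq> U \<inter> V"
      using U(1) assms(5) open_contains_cball[of "U \<inter> V"] by blast
    then show ?thesis using U(2) by blast
  qed
  then obtain r where r: "\<And>i. r i > 0" "\<And>i. cball (z i) (r i) \<subseteq> V"
      "\<And>i. h ` (cball (z i) (r i) \<inter> A) \<subseteq> mball (w i) (1 / Suc i)"
    by metis
  show thesis
  proof
    fix q assume "q \<in> topspace F"
    then have q: "q \<in> M" by (simp add: F_eq)
    have "q \<notin> F derived_set_of T" using T(4) by simp
    then have "\<exists>O'. openin F O' \<and> q \<in> O' \<and> (\<forall>y. y \<in> T \<longrightarrow> y \<in> O' \<longrightarrow> y = q)"
      using \<open>q \<in> topspace F\<close> unfolding in_derived_set_of by metis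
    then obtain O' where O': "openin F O'" "q \<in> O'" "\<And>y. y \<in> T \<Longrightarrow> y \<in> O' \<Longrightarrow> y = q"
      by metis
    obtain e where e: "e > 0" "mball q e \<subseteq> O'"
      using O'(1,2) unfolding F_eq openin_mtopology by blast
    obtain N where N: "1 / Suc N < e / 2"
      using e(1) nat_approx_posE[of "e / 2"] by auto
    have near: "w i = q" if i: "h ` (cball (z i) (r i) \<inter> A) \<inter> mball q (e / 2) \<noteq> {}" "N \<le> i" for i
    proof -
      obtain y where y: "y \<in> mball (w i) (1 / Suc i)" "y \<in> mball q (e / 2)"
        using i(1) r(3)[of i] by blast
      have "1 / real (Suc i) \<le> 1 / Suc N" using i(2) by (intro divide_left_mono) auto
      then have "d (w i) y < e / 2" using y(1) N by simp
      then have "d q (w i) < e" using y triangle[of q y "w i"] commute[of y "w i"] by simp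
      then have "w i \<in> O'" using q wM by (intro subsetD[OF e(2)]) simp
      with O'(3) wT show ?thesis by simp
    qed
    have "finite {i. w i = q}"
      using finite_vimageI[of "{q}" w] w(1) by (simp add: vimage_def)
    moreover have "{i. h ` (cball (z i) (r i) \<inter> A) \<inter> mball q (e / 2) \<noteq> {}} \<subseteq> {..<N} \<union> {i. w i = q}"
    proof
      fix i assume i: "i \<in> {i. h ` (cball (z i) (r i) \<inter> A) \<inter> mball q (e / 2) \<noteq> {}}"
      then have "N \<le> i \<Longrightarrow> w i = q" using near[of i] unfolding mem_Collect_eq by argo
      then show "i \<in> {..<N} \<union> {i. w i = q}" by (cases "N \<le> i") auto
    qed
    ultimately have "finite {i. h ` (cball (z i) (r i) \<inter> A) \<inter> mball q (e / 2) \<noteq> {}}"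
      by (meson finite_Un finite_lessThan finite_subset)
    moreover have "openin F (mball q (e / 2))" "q \<in> mball q (e / 2)"
      using q e(1) by (auto simp: F_eq)
    ultimately show "\<exists>U. openin F U \<and> q \<in> U \<and> finite {i. h ` (cball (z i) (r i) \<inter> A) \<inter> U \<noteq> {}}"
      by blast
  qed (use z r in auto)
qed

text \<open>
  As in the Cantor--Bendixson theorem, all open sets with image in a \<open>\<sigma>\<close>-compact set are removed; by
  the Lindelof property only countably many of them matter.
\<close>
lemma nowhere_sigma_compact_kernel:
  fixes A :: "'a :: euclidean_space set"
  assumes "\<not> in_sigma_compact F (h ` A)"
  obtains Z where "Z \<subseteq> A" "Z \<noteq> {}" "\<And>z V. z \<in> Z \<Longrightarrow> open V \<Longrightarrow> z \<in> V \<Longrightarrow> \<not> in_sigma_compact F (h ` (V \<inter> Z))"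
proof -
  define \<O> where "\<O> = {V. open V \<and> in_sigma_compact F (h ` (V \<inter> A))}"
  define Z where "Z = A - \<Union>\<O>"
  obtain \<O>' where \<O>': "\<O>' \<subseteq> \<O>" "countable \<O>'" "\<Union>\<O>' = \<Union>\<O>"
    using Lindelof[of \<O>] by (auto simp: \<O>_def)
  have "in_sigma_compact F (\<Union>V\<in>\<O>'. h ` (V \<inter> A))"
    using \<O>' by (intro in_sigma_compact_UN) (auto simp: \<O>_def)
  then have small: "in_sigma_compact F (h ` (A - Z))"
    by (rule in_sigma_compact_subset) (use \<O>'(3) in \<open>auto simp: Z_def\<close>)
  have big: "\<not> in_sigma_compact F (h ` (V \<inter> Z))" if V: "\<not> in_sigma_compact F (h ` (V \<inter> A))" for V
  proof
    assume "in_sigma_compact F (h ` (V \<inter> Z))"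
    from in_sigma_compact_Un[OF this small] have "in_sigma_compact F (h ` (V \<inter> A))"
      by (rule in_sigma_compact_subset) blast
    with V show False ..
  qed
  show thesis
  proof
    show "Z \<subseteq> A" by (auto simp: Z_def)
    have "\<not> in_sigma_compact F (h ` (UNIV \<inter> Z))" using big[of UNIV] assms by simp
    moreover have "in_sigma_compact F {}"
      unfolding in_sigma_compact_def by (intro exI[of _ "{}"]) simp
    ultimately show "Z \<noteq> {}" by auto
    show "\<not> in_sigma_compact F (h ` (V \<inter> Z))" if "z \<in> Z" "open V" "z \<in> V" for z V
      using big[of V] that by (auto simp: Z_def \<O>_def)
  qed
qed

text \<open>
  The combinatorial content of the theorem of Hurewicz that an analytic space which is not
  \<open>\<sigma>\<close>-compact contains a closed copy of the irrationals. The sets \<open>W s\<close> are images \<open>h ` (J \<inter> - \<rat>)\<close> of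
  compact intervals \<open>J\<close> centred in the kernel of the previous lemma, so that the branching can be repeated
  below every node. The intervals at level \<open>n + 1\<close> avoid the \<open>n\<close>-th rational: the point common to the
  intervals along a branch is then irrational, and its image lies in all the \<open>W s\<close> of that branch.
\<close>
lemma hurewicz_scheme:
  assumes "analytic_space F" "\<not> sigma_compact_space F"
  obtains W :: "nat list \<Rightarrow> 'b set" where
    "\<And>s i. W (s @ [i]) \<subseteq> W s"
    "\<And>s q. q \<in> topspace F \<Longrightarrow> \<exists>U. openin F U \<and> q \<in> U \<and> finite {i. W (s @ [i]) \<inter> U \<noteq> {}}"
    "\<And>y. \<exists>p\<in>topspace F. \<forall>n. p \<in> W (map y [0..<n])"
proof -
  obtain h where F: "metrizable_space F" and h: "continuous_map (top_of_set (- \<rat> :: real set)) F h"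
    and h_onto: "h ` (- \<rat>) = topspace F"
    using assms(1) unfolding analytic_space_def by blast
  have "\<not> in_sigma_compact F (h ` (- \<rat>))"
    using assms(2) sigma_compact_space_if_in_sigma_compact unfolding h_onto by blast
  then obtain Z where Z: "Z \<subseteq> - \<rat>" "Z \<noteq> {}"
    and big: "\<And>z V. z \<in> Z \<Longrightarrow> open V \<Longrightarrow> z \<in> V \<Longrightarrow> \<not> in_sigma_compact F (h ` (V \<inter> Z))"
    using nowhere_sigma_compact_kernel by blast
  define \<rho> :: "nat \<Rightarrow> real" where "\<rho> = from_nat_into \<rat>"
  have \<rho>: "range \<rho> = \<rat>"
    unfolding \<rho>_def by (rule range_from_nat_into) (auto simp: countable_rat)
  define J where "J x = cball (fst x) (snd x)" for x :: "real \<times> real"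
  define P where "P x \<longleftrightarrow> fst x \<in> Z \<and> snd x > 0" for x :: "real \<times> real"
  define Q where "Q s x x' \<longleftrightarrow> (\<forall>i. J (x' i) \<subseteq> J x - {\<rho> (length s)}) \<and>
      (\<forall>q\<in>topspace F. \<exists>U. openin F U \<and> q \<in> U \<and> finite {i. h ` (J (x' i) \<inter> - \<rat>) \<inter> U \<noteq> {}})"
    for s :: "nat list" and x and x' :: "nat \<Rightarrow> real \<times> real"
  have step: "\<exists>x'. (\<forall>i. P (x' i)) \<and> Q s x x'" if "P x" for s x
  proof -
    define V where "V = ball (fst x) (snd x) - {\<rho> (length s)}"
    have "open V" unfolding V_def by (intro open_Diff) auto
    have "fst x \<noteq> \<rho> (length s)" using that Z(1) \<rho> by (auto simp: P_def)
    then have "fst x \<in> V" using that by (auto simp: V_def P_def)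
    have "\<not> compactin F (F closure_of (h ` (V \<inter> Z)))"
    proof
      assume *: "compactin F (F closure_of (h ` (V \<inter> Z)))"
      have "h ` (V \<inter> Z) \<subseteq> F closure_of (h ` (V \<inter> Z))"
        using h_onto Z(1) by (intro closure_of_subset) auto
      with * have "in_sigma_compact F (h ` (V \<inter> Z))"
        unfolding in_sigma_compact_def by (intro exI[of _ "{F closure_of (h ` (V \<inter> Z))}"]) simp
      then show False using big[OF _ \<open>open V\<close> \<open>fst x \<in> V\<close>] that by (simp add: P_def)
    qed
    then obtain z r where zr: "\<And>i :: nat. z i \<in> V \<inter> Z" "\<And>i. r i > 0" "\<And>i. cball (z i) (r i) \<subseteq> V"
      "\<And>q. q \<in> topspace F \<Longrightarrow> \<exists>U. openin F U \<and> q \<in> U \<and> finite {i. h ` (cball (z i) (r i) \<inter> - \<rat>) \<inter> U \<noteq> {}}"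
      using locally_finite_neighbourhood_images[OF F h, of "V \<inter> Z" V] \<open>open V\<close> Z(1) by blast
    have VJ: "V \<subseteq> J x - {\<rho> (length s)}" by (auto simp: V_def J_def)
    have J: "J (z i, r i) = cball (z i) (r i)" for i by (simp add: J_def)
    have "Q s x (\<lambda>i. (z i, r i))"
      unfolding Q_def J using VJ zr(3,4) by (meson order_trans)
    moreover have "\<forall>i. P (z i, r i)" using zr(1,2) by (simp add: P_def)
    ultimately show ?thesis by (intro exI[of _ "\<lambda>i. (z i, r i)"]) simp
  qed
  obtain z0 where "z0 \<in> Z" using Z(2) by blast
  then have root: "P (z0, 1)" by (simp add: P_def)
  obtain X where PX: "\<And>s. P (X s)" and QX: "\<And>s. Q s (X s) (\<lambda>i. X (s @ [i]))"
    using tree_dependent_choice[of "\<lambda>_. P" _ Q, OF root step] by blast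
  have nest: "J (X (s @ [i])) \<subseteq> J (X s) - {\<rho> (length s)}" for s i
    using QX[of s] by (simp add: Q_def)
  show thesis
  proof (rule that[of "\<lambda>s. h ` (J (X s) \<inter> - \<rat>)"])
    show "h ` (J (X (s @ [i])) \<inter> - \<rat>) \<subseteq> h ` (J (X s) \<inter> - \<rat>)" for s i
      using nest[of s i] by blast
    show "\<exists>U. openin F U \<and> q \<in> U \<and> finite {i. h ` (J (X (s @ [i])) \<inter> - \<rat>) \<inter> U \<noteq> {}}"
      if "q \<in> topspace F" for s q
      using QX[of s] that by (simp add: Q_def)
    show "\<exists>p\<in>topspace F. \<forall>n. p \<in> h ` (J (X (map y [0..<n])) \<inter> - \<rat>)" for y
    proof -
      let ?J = "\<lambda>n. J (X (map y [0..<n]))"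
      have step: "?J (Suc n) \<subseteq> ?J n - {\<rho> n}" for n
        using nest[of "map y [0..<n]" "y n"] by simp
      have "\<Inter>(range ?J) \<noteq> {}"
      proof (rule compact_nest)
        show "compact (?J n)" for n by (simp add: J_def)
        show "?J n \<noteq> {}" for n using PX[of "map y [0..<n]"] by (simp add: J_def P_def)
        show "?J n \<subseteq> ?J m" if "m \<le> n" for m n
          using that by (rule lift_Suc_antimono_le[rotated]) (use step in blast)
      qed
      then obtain t where t: "\<And>n. t \<in> ?J n" by blast
      have "t \<notin> \<rat>"
      proof
        assume "t \<in> \<rat>"
        then obtain n where "t = \<rho> n" using \<rho> by (metis imageE)
        then show False using t[of "Suc n"] step[of n] by blast
      qed
      then show ?thesis using t h_onto by (intro bexI[of _ "h t"]) auto
    qed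
  qed
qed

section \<open>Finite traces of a scheme\<close>

text \<open>
  \<open>E\<close> is the image of the irrationals under some \<open>g\<close>. For a countable base of the line, \<open>D s\<close> takes
  one point of \<open>A s\<close> out of the \<open>g\<close>-image of each of the first \<open>length s\<close> basic sets, where
  possible. A point that belongs to \<open>A s\<close> for all \<open>s\<close> along a branch is then approximated
  arbitrarily well along that branch.
\<close>
lemma finite_traces_accumulating_at_branches:
  fixes A :: "nat list \<Rightarrow> 'a set"
  assumes "analytic_space E"
  obtains D :: "nat list \<Rightarrow> 'a set" where
    "\<And>s. finite (D s)" "\<And>s. D s \<subseteq> A s"
    "\<And>s. A s \<inter> topspace E \<noteq> {} \<Longrightarrow> D s \<noteq> {}"
    "\<And>y x U. \<lbrakk>\<And>n. x \<in> A (map y [0..<n]); openin E U; x \<in> U\<rbrakk> \<Longrightarrow> \<exists>n. D (map y [0..<n]) \<inter> U \<noteq> {}"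
proof -
  obtain g where g: "continuous_map (top_of_set (- \<rat> :: real set)) E g" and g_onto: "g ` (- \<rat>) = topspace E"
    using assms unfolding analytic_space_def by blast
  obtain \<B> :: "real set set" where \<B>: "countable \<B>" "\<And>B. B \<in> \<B> \<Longrightarrow> open B"
      "\<And>S. open S \<Longrightarrow> \<exists>\<U>. \<U> \<subseteq> \<B> \<and> S = \<Union>\<U>"
    using univ_second_countable by blast
  \<comment> \<open>Putting \<open>UNIV\<close> first makes \<open>D s\<close> nonempty already for \<open>s = []\<close>.\<close>
  define b where "b = case_nat UNIV (from_nat_into \<B>)"
  define C where "C s k = {t \<in> b k - \<rat>. g t \<in> A s}" for s k
  define D where "D s = (\<lambda>k. g (SOME t. t \<in> C s k)) ` {k. k \<le> length s \<and> C s k \<noteq> {}}" for s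
  have pick: "(SOME t. t \<in> C s k) \<in> C s k" if "C s k \<noteq> {}" for s k
    using that by (simp add: some_in_eq)
  show thesis
  proof (rule that[of D])
    show "finite (D s)" for s by (simp add: D_def)
    have C_sub: "g t \<in> A s" if "t \<in> C s k" for s k t
      using that by (simp add: C_def)
    show "D s \<subseteq> A s" for s
      unfolding D_def by (intro image_subsetI C_sub[OF pick]) simp
    show "D s \<noteq> {}" if ne: "A s \<inter> topspace E \<noteq> {}" for s
    proof -
      obtain x where "x \<in> A s" "x \<in> g ` (- \<rat>)" using ne g_onto by auto
      then obtain t where "t \<in> - \<rat>" "g t \<in> A s" by (metis imageE)
      then have "t \<in> C s 0" by (simp add: C_def b_def)
      then have "C s 0 \<noteq> {}" by blast
      then show ?thesis by (auto simp: D_def)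
    qed
    fix y x U assume x: "\<And>n. x \<in> A (map y [0..<n])" and U: "openin E U" "x \<in> U"
    have "x \<in> g ` (- \<rat>)" unfolding g_onto using openin_subset[OF U(1)] U(2) by (rule subsetD)
    then obtain t where t: "t \<in> - \<rat>" "g t = x" by (metis imageE)
    have "openin (top_of_set (- \<rat>)) {t \<in> topspace (top_of_set (- \<rat>)). g t \<in> U}"
      using g U(1) by (rule openin_continuous_map_preimage)
    then obtain V where V: "open V" "{t \<in> - \<rat>. g t \<in> U} = - \<rat> \<inter> V"
      by (auto simp: openin_open)
    have "t \<in> V" using V(2) t U(2) by blast
    then obtain B where B: "B \<in> \<B>" "t \<in> B" "B \<subseteq> V" using \<B>(3)[OF V(1)] by blast
    obtain j where "from_nat_into \<B> j = B" using from_nat_into_surj[OF \<B>(1) B(1)] by blast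
    then have b: "b (Suc j) = B" by (simp add: b_def)
    let ?s = "map y [0..<Suc j]"
    have "t \<in> C ?s (Suc j)" using t B b x[of "Suc j"] by (simp add: C_def)
    then have "C ?s (Suc j) \<noteq> {}" by blast
    then have "g (SOME t. t \<in> C ?s (Suc j)) \<in> D ?s" "(SOME t. t \<in> C ?s (Suc j)) \<in> C ?s (Suc j)"
      unfolding D_def by (intro imageI pick; simp)+
    moreover have "g u \<in> U" if "u \<in> C ?s (Suc j)" for u
      using that b B(3) V(2) by (auto simp: C_def)
    ultimately show "\<exists>n. D (map y [0..<n]) \<inter> U \<noteq> {}" by blast
  qed
qed

text \<open>
  If infinitely many points of the sets \<open>D t\<close> with \<open>t\<close> above \<open>s\<close> accumulate at \<open>x\<close>, then, as \<open>D s\<close> is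
  finite and only finitely many successors of \<open>s\<close> matter near \<open>x\<close>, the same happens above one of these
  successors. Repeating this produces a branch of \<open>T\<close>.
\<close>
lemma traces_locally_finite_if_unbranched:
  fixes A D :: "nat list \<Rightarrow> 'a set"
  assumes T: "\<And>s i. s @ [i] \<in> T \<Longrightarrow> s \<in> T" "\<nexists>y :: nat \<Rightarrow> nat. \<forall>n. map y [0..<n] \<in> T"
    and A: "\<And>s i. A (s @ [i]) \<subseteq> A s"
    and local: "\<And>s. \<exists>U. openin X U \<and> x \<in> U \<and> finite {i. A (s @ [i]) \<inter> U \<noteq> {}}"
    and D: "\<And>s. finite (D s)" "\<And>s. D s \<subseteq> A s"
  shows "\<exists>U. openin X U \<and> x \<in> U \<and> finite (U \<inter> (\<Union>s\<in>T. D s))"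
proof (rule ccontr)
  assume not_finite: "\<not> ?thesis"
  define above where "above s = (\<Union>t\<in>{t \<in> T. \<exists>u. t = s @ u}. D t)" for s
  define bad where "bad s \<longleftrightarrow> (\<forall>U. openin X U \<longrightarrow> x \<in> U \<longrightarrow> infinite (U \<inter> above s))" for s
  have T_prefix: "s \<in> T" if "s @ u \<in> T" for s u
    using that by (induction u rule: rev_induct) (use T(1) in \<open>auto simp flip: append_assoc\<close>)
  have A_mono: "A (s @ u) \<subseteq> A s" for s u
  proof (induction u rule: rev_induct)
    case (snoc i u)
    then show ?case using A[of "s @ u" i] by simp
  qed simp
  have "bad []"
    using not_finite by (auto simp: bad_def above_def)
  have step: "\<exists>i. bad (s @ [i])" if "bad s" for s
  proof (rule ccontr)
    assume "\<not> ?thesis"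
    then have "\<forall>i. \<exists>U. openin X U \<and> x \<in> U \<and> finite (U \<inter> above (s @ [i]))"
      unfolding bad_def by blast
    then obtain V where V: "\<And>i. openin X (V i)" "\<And>i. x \<in> V i" "\<And>i. finite (V i \<inter> above (s @ [i]))"
      by metis
    obtain U where U: "openin X U" "x \<in> U" and fin: "finite {i. A (s @ [i]) \<inter> U \<noteq> {}}"
      using local by blast
    define I where "I = {i. A (s @ [i]) \<inter> U \<noteq> {}}"
    define O' where "O' = \<Inter>(insert U (V ` I))"
    have "openin X O'" unfolding O'_def using U V(1) fin by (intro openin_Inter) (auto simp: I_def)
    moreover have "x \<in> O'" using U(2) V(2) by (auto simp: O'_def)
    moreover have "O' \<inter> above s \<subseteq> D s \<union> (\<Union>i\<in>I. V i \<inter> above (s @ [i]))"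
    proof
      fix z assume z: "z \<in> O' \<inter> above s"
      then obtain u where u: "s @ u \<in> T" "z \<in> D (s @ u)" by (auto simp: above_def)
      show "z \<in> D s \<union> (\<Union>i\<in>I. V i \<inter> above (s @ [i]))"
      proof (cases u)
        case Nil
        then show ?thesis using u by simp
      next
        case (Cons i v)
        have "z \<in> A (s @ [i])" using A_mono[of "s @ [i]" v] D(2)[of "s @ u"] u(2) Cons by auto
        then have "i \<in> I" using z by (auto simp: I_def O'_def)
        moreover have "z \<in> above (s @ [i])" using u Cons by (force simp: above_def)
        ultimately show ?thesis using z by (auto simp: O'_def)
      qed
    qed
    moreover have "finite (D s \<union> (\<Union>i\<in>I. V i \<inter> above (s @ [i])))"
      using D(1) V(3) fin by (simp add: I_def)
    ultimately show False using \<open>bad s\<close> finite_subset unfolding bad_def by blast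
  qed
  define node where "node = rec_nat [] (\<lambda>_ s. s @ [SOME i. bad (s @ [i])])"
  define y where "y n = (SOME i. bad (node n @ [i]))" for n
  have node: "node 0 = []" "node (Suc n) = node n @ [y n]" for n
    by (simp_all add: node_def y_def)
  have node_bad: "bad (node n)" for n
  proof (induction n)
    case (Suc n)
    then show ?case unfolding node(2) y_def by (rule someI_ex[OF step])
  qed (simp add: node \<open>bad []\<close>)
  have node_eq: "node n = map y [0..<n]" for n
    by (induction n) (simp_all add: node)
  have "s \<in> T" if "bad s" for s
  proof -
    obtain U where "openin X U" "x \<in> U" using local by blast
    then have "infinite (U \<inter> above s)" using that by (simp add: bad_def)
    then have "above s \<noteq> {}" by auto
    then show ?thesis using T_prefix by (auto simp: above_def)
  qed
  then show False using T(2) node_bad node_eq by metis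
qed

section \<open>Zero-dimensional closed sets are not Souslin\<close>

theorem proposition5p1:
  fixes E G :: "'a topology" and F :: "'b topology" and f :: "'a \<Rightarrow> 'b"
  assumes "analytic_space E"
    and "metrizable_space F"
    and "\<not> sigma_compact_space F"
    and "continuous_map E F f"
    and "f ` topspace E = topspace F"
    and "\<And>y. y \<in> topspace F \<Longrightarrow>
           covering_dim (subtopology E {x \<in> topspace E. f x = y}) > 0"
    and "analytic_extension G E"
    and "covering_dim (subtopology G (topspace G - topspace E)) \<le> 0"
  shows "\<not> souslin_set (effros_borel G) (zero_dim_closed G)"
proof
  assume souslin: "souslin_set (effros_borel G) (zero_dim_closed G)"
  have G: "metrizable_space G" and EG: "topspace E \<subseteq> topspace G" "E = subtopology G (topspace E)"
    using assms(7) by (auto simp: analytic_extension_def analytic_space_def)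
  have "analytic_space F"
    using assms(1,4,5,2) by (rule analytic_space_continuous_map_image)
  then obtain W :: "nat list \<Rightarrow> 'b set" where W: "\<And>s i. W (s @ [i]) \<subseteq> W s"
    "\<And>s q. q \<in> topspace F \<Longrightarrow> \<exists>U. openin F U \<and> q \<in> U \<and> finite {i. W (s @ [i]) \<inter> U \<noteq> {}}"
    "\<And>y. \<exists>p\<in>topspace F. \<forall>n. p \<in> W (map y [0..<n])"
    using hurewicz_scheme[OF _ assms(3)] by metis
  define A where "A s = {x \<in> topspace E. f x \<in> W s}" for s
  obtain D :: "nat list \<Rightarrow> 'a set" where D: "\<And>s. finite (D s)" "\<And>s. D s \<subseteq> A s"
    "\<And>s. A s \<inter> topspace E \<noteq> {} \<Longrightarrow> D s \<noteq> {}"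
    "\<And>y x U. \<lbrakk>\<And>n. x \<in> A (map y [0..<n]); openin E U; x \<in> U\<rbrakk> \<Longrightarrow> \<exists>n. D (map y [0..<n]) \<inter> U \<noteq> {}"
    using finite_traces_accumulating_at_branches[OF assms(1), of A] by metis
  have DE: "D s \<subseteq> topspace E" for s using D(2)[of s] by (auto simp: A_def)
  obtain T where T: "[] \<in> T" "\<And>s i. s @ [i] \<in> T \<Longrightarrow> s \<in> T"
    "G closure_of (\<Union>s\<in>T. D s) \<in> zero_dim_closed G \<longleftrightarrow> (\<exists>y :: nat \<Rightarrow> nat. \<forall>n. map y [0..<n] \<in> T)"
    using unbranched_not_analytic[OF analytic_property_effros[OF souslin, of D]] by metis
  define K where "K = G closure_of (\<Union>s\<in>T. D s)"
  have K: "K \<subseteq> topspace G" unfolding K_def by (rule closure_of_subset_topspace)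
  have zero: "K \<in> zero_dim_closed G \<longleftrightarrow> covering_dim_le (subtopology G K) 0 \<and> K \<noteq> {}"
    unfolding zero_dim_closed_def covering_dim_eq_0_iff using K by (auto simp: K_def)
  show False
  proof (cases "\<exists>y :: nat \<Rightarrow> nat. \<forall>n. map y [0..<n] \<in> T")
    case True
    then obtain y :: "nat \<Rightarrow> nat" where y: "\<And>n. map y [0..<n] \<in> T" by blast
    obtain p where p: "p \<in> topspace F" "\<And>n. p \<in> W (map y [0..<n])" using W(3) by blast
    let ?fib = "{x \<in> topspace E. f x = p}"
    have fib: "?fib \<subseteq> K"
    proof
      fix x assume x: "x \<in> ?fib"
      have "\<exists>z. z \<in> (\<Union>s\<in>T. D s) \<and> z \<in> U" if U: "x \<in> U" "openin G U" for U
      proof -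
        have "openin E (topspace E \<inter> U)"
          by (subst EG(2)) (rule openin_subtopology_Int2[OF U(2)])
        then have "\<exists>n. D (map y [0..<n]) \<inter> (topspace E \<inter> U) \<noteq> {}"
          by (rule D(4)[rotated]) (use x p(2) U(1) in \<open>auto simp: A_def\<close>)
        then show ?thesis using y by blast
      qed
      then show "x \<in> K" unfolding K_def in_closure_of using x EG(1) by blast
    qed
    \<comment> \<open>A branch makes \<open>K\<close> zero-dimensional by the choice of \<open>T\<close>, yet \<open>K\<close> contains a whole fibre.\<close>
    have "covering_dim_le (subtopology G K) 0" using T(3) True zero K_def by simp
    then have "covering_dim_le (subtopology (subtopology G K) ?fib) 0"
      by (rule covering_dim_le_0_subspace[OF metrizable_space_subtopology[OF G]])
    moreover have "subtopology (subtopology G K) ?fib = subtopology E ?fib"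
    proof -
      have "K \<inter> ?fib = topspace E \<inter> ?fib" using fib by auto
      then show ?thesis by (subst EG(2)) (simp add: subtopology_subtopology)
    qed
    ultimately have "covering_dim (subtopology E ?fib) \<le> 0"
      by (simp add: covering_dim_le_0_iff)
    then show False using assms(6)[OF p(1)] by simp
  next
    case False
    \<comment> \<open>Without a branch, \<open>K\<close> is zero-dimensional because the traces are locally finite in \<open>E\<close>.\<close>
    have local: "\<exists>U. openin E U \<and> x \<in> U \<and> finite (U \<inter> (\<Union>s\<in>T. D s))" if x: "x \<in> topspace E" for x
    proof (rule traces_locally_finite_if_unbranched[of T A, OF T(2) False])
      show "A (s @ [i]) \<subseteq> A s" for s i using W(1)[of s i] by (auto simp: A_def)
      show "\<exists>U. openin E U \<and> x \<in> U \<and> finite {i. A (s @ [i]) \<inter> U \<noteq> {}}" for s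
      proof -
        have "f x \<in> topspace F" using x assms(5) by blast
        then obtain O' where O': "openin F O'" "f x \<in> O'" "finite {i. W (s @ [i]) \<inter> O' \<noteq> {}}"
          using W(2) by blast
        have "{i. A (s @ [i]) \<inter> {x \<in> topspace E. f x \<in> O'} \<noteq> {}} \<subseteq> {i. W (s @ [i]) \<inter> O' \<noteq> {}}"
          by (auto simp: A_def)
        then have "finite {i. A (s @ [i]) \<inter> {x \<in> topspace E. f x \<in> O'} \<noteq> {}}"
          using O'(3) by (rule finite_subset)
        moreover have "openin E {x \<in> topspace E. f x \<in> O'}"
          using assms(4) O'(1) by (rule openin_continuous_map_preimage)
        ultimately show ?thesis using x O'(2) by blast
      qed
    qed (use D in auto)
    have "covering_dim_le (subtopology G K) 0"
      unfolding K_def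
    proof (rule covering_dim_le_0_closure_of_locally_finite[OF G EG(1)])
      show "(\<Union>s\<in>T. D s) \<subseteq> topspace E" using DE by blast
      show "\<exists>U. openin (subtopology G (topspace E)) U \<and> x \<in> U \<and> finite (U \<inter> (\<Union>s\<in>T. D s))"
        if "x \<in> topspace E" for x
        using local[OF that] EG(2) by simp
      show "covering_dim_le (subtopology G (topspace G - topspace E)) 0"
        using assms(8) by (simp add: covering_dim_le_0_iff)
    qed
    moreover have "K \<noteq> {}"
    proof -
      obtain p where p: "p \<in> topspace F" "p \<in> W []"
        using W(3)[of "\<lambda>_. 0"] by (metis list.simps(8) upt_0)
      then obtain x where "x \<in> topspace E" "f x = p" using assms(5) by (metis imageE)
      then have "D [] \<noteq> {}" using p by (intro D(3)) (auto simp: A_def)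
      moreover have "(\<Union>s\<in>T. D s) \<subseteq> K"
        unfolding K_def using DE EG(1) by (intro closure_of_subset) blast
      ultimately show ?thesis using T(1) by blast
    qed
    ultimately show False using T(3) False zero K_def by simp
  qed
qed

end
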